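(* Consider a two-player game played on a board that is a finite set of cells in $\mathbb{Z}^2$ (each cell identified with its Cartesian coordinates $(x,y)$), under one of the three move rules (4-move, 6-move or 8-move) described in the context. Let $B$ and $R$ be the initial positions (sets of occupied cells) of the two armies, with $|B|=|R|=s$. Then no complete game (ending when one player first has her men occupying every cell of the opponent's initial set of cells) can be shorter than $h$ moves, where $$h=\max\{0,\,d(B,R)-2\}+2s-1 .$$
   Context: Move rules. A set $D$ of allowed direction vectors is fixed: under 4-move rules $D=\{(\pm1,0),(0,\pm1)\}$; under 6-move rules $D=\{(\pm1,0),(0,\pm1),\pm(1,1)\}$; under 8-move rules $D=\{(a,b): a,b\in\{-1,0,1\},(a,b)\neq(0,0)\}$. Each player owns an army of identical men occupying distinct cells. A move consists of moving a single man of one's own army either by (i) a step: from cell $p$ to an empty cell $p+v$ with $v\in D$, or (ii) a chain of one or more jumps: each jump goes from $p$ over an occupied cell $p+v$ (occupied by a man of either army), $v\in D$, into an empty cell $p+2v$; jumped men are not removed, and the chain may be stopped at any time. Players alternate moves. The length of a game is the total number of moves made by both players. The winner is the first player whose men occupy all cells of the opponent's initial position. Distance. The norm of $(x,y)$ is $\max(|x|,|y|)$ under 8-move rules, $|x|+|y|$ under 4-move rules, and $\tfrac12(|x|+|y|+|x-y|)$ under 6-move rules. The distance between cells is $d(\mathbf a,\mathbf b)=\|\mathbf a-\mathbf b\|$, and between two sets of cells $d(B,R)=\min\{d(\mathbf b,\mathbf r):\mathbf b\in B,\mathbf r\in R\}$. *)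

theory Defs
  imports Main "HOL-Library.Product_Plus"
begin

type_synonym cell = "int \<times> int"

datatype move_rule = Four_Move | Six_Move | Eight_Move

fun directions :: "move_rule \<Rightarrow> cell set" where
  "directions Four_Move = {(1, 0), (-1, 0), (0, 1), (0, -1)}"
| "directions Six_Move = {(1, 0), (-1, 0), (0, 1), (0, -1), (1, 1), (-1, -1)}"
| "directions Eight_Move = {(a, b). a \<in> {-1, 0, 1} \<and> b \<in> {-1, 0, 1} \<and> (a, b) \<noteq> (0, 0)}"

(* The division by 2 is exact, see even_six_move_sum. *)
fun cell_norm :: "move_rule \<Rightarrow> cell \<Rightarrow> int" where
  "cell_norm Four_Move (x, y) = \<bar>x\<bar> + \<bar>y\<bar>"
| "cell_norm Six_Move (x, y) = (\<bar>x\<bar> + \<bar>y\<bar> + \<bar>x - y\<bar>) div 2"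
| "cell_norm Eight_Move (x, y) = max \<bar>x\<bar> \<bar>y\<bar>"

lemma even_six_move_sum: "even (\<bar>x\<bar> + \<bar>y\<bar> + \<bar>x - y\<bar>)" for x y :: int
  by presburger

definition cell_dist :: "move_rule \<Rightarrow> cell \<Rightarrow> cell \<Rightarrow> int" where
  "cell_dist mr a b = cell_norm mr (a - b)"

(* Only meaningful for finite nonempty sets. *)
definition set_dist :: "move_rule \<Rightarrow> cell set \<Rightarrow> cell set \<Rightarrow> int" where
  "set_dist mr B R = Min {cell_dist mr b r | b r. b \<in> B \<and> r \<in> R}"

datatype player = Blue | Red

fun opponent :: "player \<Rightarrow> player" where
  "opponent Blue = Red"
| "opponent Red = Blue"

(* The men of one army are identical and stand on distinct cells, so an army is its set of cells. *)
type_synonym position = "player \<Rightarrow> cell set"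

fun initial_position :: "cell set \<Rightarrow> cell set \<Rightarrow> position" where
  "initial_position B R Blue = B"
| "initial_position B R Red = R"

definition occupied :: "position \<Rightarrow> cell set" where
  "occupied pos = pos Blue \<union> pos Red"

(* In the next two definitions T is the set of cells occupied by all men except the moving one. *)
definition step :: "move_rule \<Rightarrow> cell set \<Rightarrow> cell set \<Rightarrow> cell \<Rightarrow> cell \<Rightarrow> bool" where
  "step mr board T p q \<longleftrightarrow>
     (\<exists>v \<in> directions mr. q = p + v \<and> q \<in> board \<and> q \<notin> T)"

definition jump :: "move_rule \<Rightarrow> cell set \<Rightarrow> cell set \<Rightarrow> cell \<Rightarrow> cell \<Rightarrow> bool" where
  "jump mr board T p q \<longleftrightarrow>
     (\<exists>v \<in> directions mr. p + v \<in> T \<and> q = p + v + v \<and> q \<in> board \<and> q \<notin> T)"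

(* The cell the moving man starts from counts as empty during a chain of jumps: it cannot be
   jumped over, but it can be landed on. *)
definition legal_move :: "move_rule \<Rightarrow> cell set \<Rightarrow> player \<Rightarrow> position \<Rightarrow> position \<Rightarrow> bool" where
  "legal_move mr board pl pos pos' \<longleftrightarrow>
     (\<exists>p \<in> pos pl. \<exists>q.
        (step mr board (occupied pos - {p}) p q \<or>
         (jump mr board (occupied pos - {p}))\<^sup>+\<^sup>+ p q) \<and>
        pos' = pos(pl := insert q (pos pl - {p})))"

definition has_won :: "position \<Rightarrow> position \<Rightarrow> player \<Rightarrow> bool" where
  "has_won init pos pl \<longleftrightarrow> init (opponent pl) \<subseteq> pos pl"

definition mover :: "player \<Rightarrow> nat \<Rightarrow> player" where
  "mover starter i = (if even i then starter else opponent starter)"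

(* A game is recorded as its list of positions, the initial one included. *)
definition complete_game ::
    "move_rule \<Rightarrow> cell set \<Rightarrow> position \<Rightarrow> player \<Rightarrow> position list \<Rightarrow> bool" where
  "complete_game mr board init starter ps \<longleftrightarrow>
     ps \<noteq> [] \<and> hd ps = init \<and>
     (\<forall>i. Suc i < length ps \<longrightarrow>
        (\<forall>pl. \<not> has_won init (ps ! i) pl) \<and>
        legal_move mr board (mover starter i) (ps ! i) (ps ! Suc i)) \<and>
     (\<exists>pl. has_won init (last ps) pl)"

definition game_length :: "position list \<Rightarrow> nat" where
  "game_length ps = length ps - 1"

end

theory Submission imports Defs begin

text \<open>As long as the armies are at distance at least 3, no man can jump over a man of the other
  army, so every cell reached by a move is one direction vector away from a man of the mover's own
  army, and the distance from the mover's army to the other army and to its initial cells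
  decreases by at most 1. Hence during the first \<open>d(B,R) - 2\<close> moves no man enters the opponent's
  initial cells. From then on the eventual winner gains at most one such cell with each of her own
  moves, and she needs \<open>s\<close> of them, which takes at least \<open>2s - 1\<close> moves of both players together.\<close>

lemma cell_dist_commute: "cell_dist mr a b = cell_dist mr b a"
  by (cases mr; cases a; cases b) (auto simp: cell_dist_def)

lemma cell_dist_self: "cell_dist mr a a = 0"
  by (cases mr; cases a) (auto simp: cell_dist_def zero_prod_def)

text \<open>Each direction vector has norm 1 under its own move rule, so this is an instance of the
  triangle inequality.\<close>

lemma cell_dist_add_direction:
  assumes "v \<in> directions mr"
  shows "cell_dist mr a x \<le> cell_dist mr (a + v) x + 1"
proof -
  obtain a1 a2 x1 x2 v1 v2 where [simp]: "a = (a1, a2)" "x = (x1, x2)" "v = (v1, v2)"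
    by (metis surj_pair)
  show ?thesis
  proof (cases mr)
    case Six_Move
    \<comment> \<open>Twice the claim, free of \<open>div\<close>, can be checked direction by
      direction; halving it is left to linear arithmetic.\<close>
    have "\<bar>a1 - x1\<bar> + \<bar>a2 - x2\<bar> + \<bar>a1 - x1 - (a2 - x2)\<bar>
        \<le> \<bar>a1 + v1 - x1\<bar> + \<bar>a2 + v2 - x2\<bar> + \<bar>a1 + v1 - x1 - (a2 + v2 - x2)\<bar> + 2"
      using assms Six_Move by auto
    then show ?thesis
      unfolding Six_Move cell_dist_def by simp linarith
  qed (use assms in \<open>auto simp: cell_dist_def\<close>)
qed

lemma cell_dist_direction:
  assumes "v \<in> directions mr"
  shows "cell_dist mr a (a + v) \<le> 1"
  using cell_dist_add_direction[OF assms, of a "a + v"] by (simp add: cell_dist_self)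

lemma set_dist_le:
  assumes "finite B" "finite R" "b \<in> B" "r \<in> R"
  shows "set_dist mr B R \<le> cell_dist mr b r"
proof -
  have "{cell_dist mr b r | b r. b \<in> B \<and> r \<in> R} = (\<lambda>(b, r). cell_dist mr b r) ` (B \<times> R)"
    by auto
  then have "finite {cell_dist mr b r | b r. b \<in> B \<and> r \<in> R}"
    using assms by simp
  then show ?thesis
    unfolding set_dist_def using assms by (intro Min_le) blast+
qed

text \<open>\<open>P\<close> stands for the mover's army and \<open>X\<close> for the cells
  approached. The loss of 1 does not add up along a chain: each landing cell is one direction vector
  beyond a jumped man, and that man stands in \<open>P\<close>, at the full distance
  \<open>e\<close> from \<open>X\<close>.\<close>

lemma jumps_far:
  assumes "(jump mr board T)\<^sup>+\<^sup>+ p q" "p \<in> P" "T \<subseteq> P \<union> X"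
    and far: "\<And>a x. a \<in> P \<Longrightarrow> x \<in> X \<Longrightarrow> e \<le> cell_dist mr a x"
    and "e \<ge> 3" "x \<in> X"
  shows "e - 1 \<le> cell_dist mr q x"
proof -
  have land: "\<forall>x\<in>X. e - 1 \<le> cell_dist mr b x"
    if jump: "jump mr board T a b" and a: "\<forall>x\<in>X. e - 1 \<le> cell_dist mr a x" for a b
  proof -
    obtain v where v: "v \<in> directions mr" "a + v \<in> T" "b = a + v + v"
      using jump unfolding jump_def by blast
    \<comment> \<open>A man of \<open>X\<close> at \<open>a + v\<close> would be within distance 1
      of \<open>a\<close>, whereas \<open>a\<close> keeps distance at least \<open>e - 1\<close>,
      which is at least 2.\<close>
    have "a + v \<notin> X"
      using cell_dist_direction[OF v(1), of a] a \<open>e \<ge> 3\<close> by fastforce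
    then have "a + v \<in> P"
      using v(2) \<open>T \<subseteq> P \<union> X\<close> by auto
    then have "e \<le> cell_dist mr b x + 1" if "x \<in> X" for x
      using far[of "a + v" x] that cell_dist_add_direction[OF v(1), of "a + v" x] v(3) by simp
    then show ?thesis
      by (simp add: diff_le_eq)
  qed
  have "\<forall>x\<in>X. e - 1 \<le> cell_dist mr q x"
    using assms(1)
  proof (induction rule: tranclp_induct)
    case (base b)
    have "\<forall>x\<in>X. e - 1 \<le> cell_dist mr p x"
      using far[OF \<open>p \<in> P\<close>] by fastforce
    with base show ?case
      by (rule land)
  next
    case (step b c)
    then show ?case
      using land by blast
  qed
  with \<open>x \<in> X\<close> show ?thesis by blast
qed

text \<open>\<open>X\<close> may be larger than the opposing army, so that the opponent's initial
  cells can be included when the lemma is applied.\<close>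

lemma legal_move_far:
  assumes "legal_move mr board pl pos pos'" "pos (opponent pl) \<subseteq> X"
    and far: "\<And>a x. a \<in> pos pl \<Longrightarrow> x \<in> X \<Longrightarrow> e \<le> cell_dist mr a x"
    and "e \<ge> 3" "a \<in> pos' pl" "x \<in> X"
  shows "e - 1 \<le> cell_dist mr a x"
proof -
  obtain p q where p: "p \<in> pos pl"
    and move: "step mr board (occupied pos - {p}) p q \<or>
      (jump mr board (occupied pos - {p}))\<^sup>+\<^sup>+ p q"
    and pos': "pos' = pos(pl := insert q (pos pl - {p}))"
    using assms(1) unfolding legal_move_def by blast
  have T: "occupied pos - {p} \<subseteq> pos pl \<union> X"
    using assms(2) by (cases pl) (auto simp: occupied_def)
  have q: "e - 1 \<le> cell_dist mr q x"
    using move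
  proof
    assume "step mr board (occupied pos - {p}) p q"
    then obtain v where "v \<in> directions mr" "q = p + v"
      unfolding step_def by blast
    then show ?thesis
      using cell_dist_add_direction[of v mr p x] far[OF p \<open>x \<in> X\<close>] by simp
  next
    assume "(jump mr board (occupied pos - {p}))\<^sup>+\<^sup>+ p q"
    then show ?thesis
      using p T far \<open>e \<ge> 3\<close> \<open>x \<in> X\<close> by (rule jumps_far)
  qed
  show ?thesis
    using q assms(5) pos' far[of a x] \<open>x \<in> X\<close> by auto
qed

lemma legal_move_other:
  assumes "legal_move mr board pl pos pos'" "pl' \<noteq> pl"
  shows "pos' pl' = pos pl'"
  using assms unfolding legal_move_def by auto

lemma legal_move_card_goal:
  assumes "legal_move mr board pl pos pos'" "finite G"
  shows "card (pos' pl \<inter> G) \<le> Suc (card (pos pl \<inter> G))"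
proof -
  obtain p q where "pos' = pos(pl := insert q (pos pl - {p}))"
    using assms(1) unfolding legal_move_def by blast
  then have "pos' pl \<inter> G \<subseteq> insert q (pos pl \<inter> G)"
    by auto
  then have "card (pos' pl \<inter> G) \<le> card (insert q (pos pl \<inter> G))"
    using assms(2) by (intro card_mono) auto
  also have "\<dots> \<le> Suc (card (pos pl \<inter> G))"
    using assms(2) by (simp add: card_insert_if)
  finally show ?thesis .
qed

lemma opponent_neq [simp]: "opponent pl \<noteq> pl"
  by (cases pl) auto

lemma opponent_opponent [simp]: "opponent (opponent pl) = pl"
  by (cases pl) auto

lemma neq_imp_opponent: "pl' \<noteq> pl \<Longrightarrow> pl' = opponent pl"
  by (cases pl; cases pl') auto

lemma mover_Suc: "mover starter (Suc i) = opponent (mover starter i)"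
  by (auto simp: mover_def)

text \<open>The induction needs both sets of targets: distance to the current opposing army rules
  out jumps over it, and distance to the initial cells is what the theorem uses. The bound on
  \<open>t\<close> keeps the distance at least 3 before each of the first \<open>t\<close>
  moves.\<close>

lemma game_far:
  assumes moves: "\<And>i. Suc i < length ps \<Longrightarrow>
      legal_move mr board (mover starter i) (ps ! i) (ps ! Suc i)"
    and init: "\<And>pl a x. a \<in> (ps ! 0) pl \<Longrightarrow> x \<in> (ps ! 0) (opponent pl) \<Longrightarrow> d \<le> cell_dist mr a x"
    and "t < length ps" "int t \<le> d - 2"
    and "a \<in> (ps ! t) pl" "x \<in> (ps ! t) (opponent pl) \<union> (ps ! 0) (opponent pl)"
  shows "d - int t \<le> cell_dist mr a x"
  using assms(3-)
proof (induction t arbitrary: pl a x)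
  case 0
  then show ?case using init by auto
next
  case (Suc t)
  define m where "m = mover starter t"
  have move: "legal_move mr board m (ps ! t) (ps ! Suc t)"
    using moves[of t] Suc.prems unfolding m_def by simp
  define X where "X = (ps ! t) (opponent m) \<union> (ps ! 0) (opponent m)"
  have IH: "d - int t \<le> cell_dist mr a x"
    if "a \<in> (ps ! t) pl" "x \<in> (ps ! t) (opponent pl) \<union> (ps ! 0) (opponent pl)" for pl a x
    using Suc.IH[OF _ _ that] Suc.prems by simp
  have far: "d - int t - 1 \<le> cell_dist mr a x" if "a \<in> (ps ! Suc t) m" "x \<in> X" for a x
    by (rule legal_move_far[OF move _ _ _ that]) (use IH Suc.prems in \<open>auto simp: X_def\<close>)
  have other: "(ps ! Suc t) (opponent m) = (ps ! t) (opponent m)"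
    using legal_move_other[OF move] by simp
  show ?case
  proof (cases "pl = m")
    case True
    then show ?thesis
      using far[of a x] Suc.prems other by (auto simp: X_def)
  next
    case False
    then have pl: "pl = opponent m"
      by (rule neq_imp_opponent)
    \<comment> \<open>Here \<open>pl\<close> did not move. If \<open>x\<close> is a man of the
      mover, \<open>far\<close> applies with the roles of \<open>a\<close> and \<open>x\<close>
      exchanged; otherwise \<open>x\<close> is an initial cell of the mover and the induction
      hypothesis suffices.\<close>
    show ?thesis
    proof (cases "x \<in> (ps ! Suc t) m")
      case True
      then show ?thesis
        using far[of x a] Suc.prems other pl by (auto simp: X_def cell_dist_commute[of mr a])
    next
      case False
      then show ?thesis
        using IH[of a pl x] Suc.prems other pl by auto
    qed
  qed
qed

text \<open>Of the \<open>m\<close> moves after position \<open>k\<close>, \<open>pl\<close> makes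
  half, rounded down if she is next to move and rounded up otherwise; the last summand records this
  parity. Each of her moves gains at most one cell of \<open>G\<close>.\<close>

lemma game_card_goal:
  assumes moves: "\<And>i. Suc i < length ps \<Longrightarrow>
      legal_move mr board (mover starter i) (ps ! i) (ps ! Suc i)"
    and "finite G" "(ps ! k) pl \<inter> G = {}" "k + m < length ps"
  shows "2 * card ((ps ! (k + m)) pl \<inter> G) \<le> m + (if mover starter (k + m) = pl then 0 else 1)"
  using assms(4)
proof (induction m)
  case 0
  then show ?case using assms by simp
next
  case (Suc m)
  have move: "legal_move mr board (mover starter (k + m)) (ps ! (k + m)) (ps ! Suc (k + m))"
    using moves[of "k + m"] Suc.prems by simp
  show ?case
  proof (cases "mover starter (k + m) = pl")
    case True
    then show ?thesis
      using Suc legal_move_card_goal[OF move \<open>finite G\<close>] by (auto simp: mover_Suc)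
  next
    case False
    then have "opponent (mover starter (k + m)) = pl"
      using neq_imp_opponent by metis
    then show ?thesis
      using False Suc legal_move_other[OF move, of pl] by (auto simp: mover_Suc)
  qed
qed

theorem theorem1:
  fixes mr :: move_rule
    and board B R :: "cell set"
    and s :: nat
    and starter :: player
    and ps :: "position list"
  assumes "finite board"
    and "B \<subseteq> board" and "R \<subseteq> board" and "B \<inter> R = {}"
    and "card B = s" and "card R = s" and "s \<ge> 1"
    and "complete_game mr board (initial_position B R) starter ps"
  shows "int (game_length ps) \<ge> max 0 (set_dist mr B R - 2) + 2 * int s - 1"
proof -
  define d where "d = set_dist mr B R"
  \<comment> \<open>Truncation by \<open>nat\<close> yields the maximum with 0 in the claim.\<close>
  define k where "k = nat (d - 2)"
  have fin: "finite B" "finite R"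
    using assms finite_subset by auto
  have "ps \<noteq> []" and ps0: "ps ! 0 = initial_position B R"
    and moves: "\<And>i. Suc i < length ps \<Longrightarrow>
      legal_move mr board (mover starter i) (ps ! i) (ps ! Suc i)"
    using assms(8) unfolding complete_game_def by (auto simp: hd_conv_nth)
  obtain pl where "has_won (initial_position B R) (last ps) pl"
    using assms(8) unfolding complete_game_def by blast
  define G where "G = initial_position B R (opponent pl)"
  have won: "G \<subseteq> (ps ! (length ps - 1)) pl"
    using \<open>has_won _ _ _\<close> \<open>ps \<noteq> []\<close> by (simp add: has_won_def G_def last_conv_nth)
  have G: "finite G" "card G = s"
    using assms fin by (cases pl; simp add: G_def)+
  have init: "d \<le> cell_dist mr a x"
    if "a \<in> (ps ! 0) pl" "x \<in> (ps ! 0) (opponent pl)" for pl a x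
    using that set_dist_le[OF fin, of a x mr] set_dist_le[OF fin, of x a mr]
    by (cases pl) (auto simp: ps0 d_def cell_dist_commute[of mr a])
  have empty: "(ps ! t) pl \<inter> G = {}" if "t \<le> k" "t < length ps" for t
  \<comment> \<open>The initial position is treated separately because \<open>d - 2\<close> may be
    negative; there disjointness of \<open>B\<close> and \<open>R\<close> suffices. A positive
    \<open>t\<close> with \<open>t \<le> k\<close> forces \<open>k\<close> to equal
    \<open>d - 2\<close>.\<close>
  proof (cases "t = 0")
    case True
    then show ?thesis
      using assms(4) by (cases pl) (auto simp: ps0 G_def)
  next
    case False
    then have t: "int t \<le> d - 2"
      using \<open>t \<le> k\<close> by (simp add: k_def)
    show ?thesis
    proof (rule ccontr)
      assume "(ps ! t) pl \<inter> G \<noteq> {}"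
      then obtain a where "a \<in> (ps ! t) pl" "a \<in> (ps ! 0) (opponent pl)"
        by (auto simp: G_def ps0)
      then have "d - int t \<le> cell_dist mr a a"
        using game_far[of ps mr board starter d, OF _ _ \<open>t < length ps\<close> t] moves init by blast
      with t show False
        by (simp add: cell_dist_self)
    qed
  qed
  have "G \<noteq> {}"
    using G \<open>s \<ge> 1\<close> by auto
  \<comment> \<open>Otherwise the final position would fall under \<open>empty\<close>, although the
    winner occupies all of the nonempty \<open>G\<close> there.\<close>
  then have k: "k < length ps - 1"
    using empty[of "length ps - 1"] won \<open>ps \<noteq> []\<close> by (force simp: not_less)
  then obtain m where m: "length ps - 1 = k + m"
    by (metis less_imp_add_positive)
  have "(ps ! (k + m)) pl \<inter> G = G"
    using won m by auto
  moreover have "2 * card ((ps ! (k + m)) pl \<inter> G)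
      \<le> m + (if mover starter (k + m) = pl then 0 else 1)"
    by (rule game_card_goal[OF _ G(1) empty[of k]]) (use moves m k in auto)
  ultimately have "2 * s \<le> m + 1"
    using G by (simp split: if_splits)
  then show ?thesis
    using m by (simp add: game_length_def k_def d_def)
qed

end
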